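(* Let $B$ be the Boolean ring of measurable subsets of $[0,1]$ modulo sets of measure zero, with the topology given by the metric $d([S],[T])=\mu(S+T)$. Every prime ideal $P$ of the ring $B$ has for topological closure the whole ring $B$. Hence $B$ has no closed prime ideals.
   Context: Let $\mu$ be Lebesgue measure on $[0,1]$ and $B_0$ the set of Lebesgue measurable subsets of $[0,1]$, a Boolean ring under $0=\emptyset$, $1=[0,1]$, $S+T=(S\cup T)\setminus(S\cap T)$, $ST=S\cap T$. Let $B=B_0/\{S\in B_0\mid \mu(S)=0\}$, and write $[S]$ for the image in $B$ of $S\in B_0$. The formula $d([S],[T])=\mu(S+T)$ gives a well-defined metric on $B$. Prime ideals are by definition proper. *)

theory Defs
  imports "HOL-Analysis.Analysis" "HOL-Algebra.QuotRing"
begin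

abbreviation unit_lebesgue :: "real measure" where
  "unit_lebesgue \<equiv> lebesgue_on {0..1}"

definition measurable_set_ring :: "real set ring" where
  "measurable_set_ring =
     \<lparr>carrier = sets unit_lebesgue, mult = (\<lambda>S T. S \<inter> T), one = {0..1}, zero = {},
      add = (\<lambda>S T. (S \<union> T) - (S \<inter> T))\<rparr>"

definition measure_ring :: "real set set ring" where
  "measure_ring = measurable_set_ring Quot null_sets unit_lebesgue"

definition measure_class :: "real set \<Rightarrow> real set set" where
  "measure_class S = null_sets unit_lebesgue +>\<^bsub>measurable_set_ring\<^esub> S"

text \<open>
  The distance is computed on arbitrarily chosen representatives; independence of the choice is
  \<open>measure_class_dist_eq\<close> below. Arguments outside the carrier are irrelevant.
\<close>

definition measure_class_dist :: "real set set \<Rightarrow> real set set \<Rightarrow> real" where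
  "measure_class_dist X Y =
     measure unit_lebesgue ((SOME S. S \<in> X) \<oplus>\<^bsub>measurable_set_ring\<^esub> (SOME T. T \<in> Y))"

definition measure_ring_topology :: "real set set topology" where
  "measure_ring_topology = Metric_space.mtopology (carrier measure_ring) measure_class_dist"

lemma measurable_set_ring_simps [simp]:
  "carrier measurable_set_ring = sets unit_lebesgue"
  "S \<otimes>\<^bsub>measurable_set_ring\<^esub> T = S \<inter> T"
  "\<one>\<^bsub>measurable_set_ring\<^esub> = {0..1}"
  "\<zero>\<^bsub>measurable_set_ring\<^esub> = {}"
  "S \<oplus>\<^bsub>measurable_set_ring\<^esub> T = (S \<union> T) - (S \<inter> T)"
  by (simp_all add: measurable_set_ring_def)

lemma finite_measure_unit_lebesgue: "finite_measure unit_lebesgue"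
  by (rule finite_measure_lebesgue_on) simp

lemma unit_interval_in_sets: "{0..1} \<in> sets unit_lebesgue"
  using sets.top[of unit_lebesgue] by simp

lemma sets_unit_lebesgue_subset: "S \<in> sets unit_lebesgue \<Longrightarrow> S \<subseteq> {0..1}"
  using sets.sets_into_space[of S unit_lebesgue] by simp

lemma cring_measurable_set_ring: "cring measurable_set_ring"
proof (rule cringI)
  show "abelian_group measurable_set_ring"
  proof (rule abelian_groupI)
    fix S assume "S \<in> carrier measurable_set_ring"
    then show "\<exists>T\<in>carrier measurable_set_ring. T \<oplus>\<^bsub>measurable_set_ring\<^esub> S = \<zero>\<^bsub>measurable_set_ring\<^esub>"
      by (intro bexI[of _ S]) auto
  qed auto
  show "comm_monoid measurable_set_ring"
    by (rule comm_monoidI)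
      (use unit_interval_in_sets sets_unit_lebesgue_subset in \<open>auto simp: Int_assoc\<close>)
qed auto

lemma ideal_null_sets: "ideal (null_sets unit_lebesgue) measurable_set_ring"
proof (rule idealI)
  interpret cring measurable_set_ring by (rule cring_measurable_set_ring)
  show "ring measurable_set_ring" by (rule ring_axioms)
  show "subgroup (null_sets unit_lebesgue) (add_monoid measurable_set_ring)"
  proof (rule group.subgroupI[OF a_group])
    fix S assume S: "S \<in> null_sets unit_lebesgue"
    then have "\<ominus>\<^bsub>measurable_set_ring\<^esub> S = S"
      by (intro minus_equality) auto
    with S show "inv\<^bsub>add_monoid measurable_set_ring\<^esub> S \<in> null_sets unit_lebesgue"
      by (simp add: a_inv_def)
  next
    fix S T assume "S \<in> null_sets unit_lebesgue" "T \<in> null_sets unit_lebesgue"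
    then show "S \<otimes>\<^bsub>add_monoid measurable_set_ring\<^esub> T \<in> null_sets unit_lebesgue"
      by (auto intro!: null_set_Diff)
  qed (auto intro: null_sets.empty_sets)
next
  fix N S assume "N \<in> null_sets unit_lebesgue" "S \<in> carrier measurable_set_ring"
  then show "S \<otimes>\<^bsub>measurable_set_ring\<^esub> N \<in> null_sets unit_lebesgue"
    and "N \<otimes>\<^bsub>measurable_set_ring\<^esub> S \<in> null_sets unit_lebesgue"
    by (simp_all add: null_set_Int1 null_set_Int2)
qed

lemma cring_measure_ring: "cring measure_ring"
  unfolding measure_ring_def
  by (rule ideal.quotient_is_cring[OF ideal_null_sets cring_measurable_set_ring])

lemma carrier_measure_ring: "carrier measure_ring = measure_class ` sets unit_lebesgue"
  by (auto simp only: measure_ring_def measure_class_def FactRing_def A_RCOSETS_def' partial_object.simps measurable_set_ring_simps)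

lemma mem_measure_class_iff:
  assumes "S \<in> sets unit_lebesgue"
  shows "T \<in> measure_class S \<longleftrightarrow>
           T \<in> sets unit_lebesgue \<and> (S \<union> T) - (S \<inter> T) \<in> null_sets unit_lebesgue"
proof
  assume "T \<in> measure_class S"
  then obtain N where N: "N \<in> null_sets unit_lebesgue" and T: "T = (N \<union> S) - (N \<inter> S)"
    by (auto simp: measure_class_def a_r_coset_def r_coset_def)
  have "(S \<union> T) - (S \<inter> T) = N" using T by auto
  with N T assms show "T \<in> sets unit_lebesgue \<and> (S \<union> T) - (S \<inter> T) \<in> null_sets unit_lebesgue"
    by auto
next
  assume *: "T \<in> sets unit_lebesgue \<and> (S \<union> T) - (S \<inter> T) \<in> null_sets unit_lebesgue"
  have "T = (((S \<union> T) - (S \<inter> T)) \<union> S) - (((S \<union> T) - (S \<inter> T)) \<inter> S)" by auto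
  with * show "T \<in> measure_class S"
    unfolding measure_class_def a_r_coset_def r_coset_def by auto
qed

lemma measure_class_self: "S \<in> sets unit_lebesgue \<Longrightarrow> S \<in> measure_class S"
  by (simp add: mem_measure_class_iff)

lemma measure_class_eq_iff:
  assumes S: "S \<in> sets unit_lebesgue" and T: "T \<in> sets unit_lebesgue"
  shows "measure_class S = measure_class T \<longleftrightarrow> (S \<union> T) - (S \<inter> T) \<in> null_sets unit_lebesgue"
proof
  assume "measure_class S = measure_class T"
  then show "(S \<union> T) - (S \<inter> T) \<in> null_sets unit_lebesgue"
    using measure_class_self[OF T] mem_measure_class_iff[OF S] by blast
next
  assume "(S \<union> T) - (S \<inter> T) \<in> null_sets unit_lebesgue"
  then have "T \<in> measure_class S" using mem_measure_class_iff[OF S] T by blast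
  then show "measure_class S = measure_class T"
    unfolding measure_class_def
    using abelian_group.a_repr_independence[OF ring.is_abelian_group[OF cring.axioms(1)[OF cring_measurable_set_ring]]]
      additive_subgroup.a_subgroup[OF ideal.axioms(1)[OF ideal_null_sets]] S
    by simp
qed

lemma measure_class_dist_eq:
  assumes S: "S \<in> sets unit_lebesgue" and T: "T \<in> sets unit_lebesgue"
  shows "measure_class_dist (measure_class S) (measure_class T) =
           measure unit_lebesgue ((S \<union> T) - (S \<inter> T))"
proof -
  define S' where "S' = (SOME U. U \<in> measure_class S)"
  define T' where "T' = (SOME U. U \<in> measure_class T)"
  have "S' \<in> measure_class S" unfolding S'_def by (rule someI, rule measure_class_self[OF S])
  then have S': "S' \<in> sets unit_lebesgue" "(S \<union> S') - (S \<inter> S') \<in> null_sets unit_lebesgue"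
    using mem_measure_class_iff[OF S] by auto
  have "T' \<in> measure_class T" unfolding T'_def by (rule someI, rule measure_class_self[OF T])
  then have T': "T' \<in> sets unit_lebesgue" "(T \<union> T') - (T \<inter> T') \<in> null_sets unit_lebesgue"
    using mem_measure_class_iff[OF T] by auto
  have "AE x in unit_lebesgue. x \<notin> (S \<union> S') - (S \<inter> S')"
    "AE x in unit_lebesgue. x \<notin> (T \<union> T') - (T \<inter> T')"
    using S'(2) T'(2) by (simp_all only: AE_not_in)
  then have "AE x in unit_lebesgue. x \<in> (S' \<union> T') - (S' \<inter> T') \<longleftrightarrow> x \<in> (S \<union> T) - (S \<inter> T)"
    by eventually_elim auto
  then have "measure unit_lebesgue ((S' \<union> T') - (S' \<inter> T')) =
      measure unit_lebesgue ((S \<union> T) - (S \<inter> T))"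
    using S T S'(1) T'(1) by (intro measure_eq_AE) auto
  then show ?thesis
    by (simp add: measure_class_dist_def S'_def T'_def)
qed

lemma Metric_space_measure_ring: "Metric_space (carrier measure_ring) measure_class_dist"
proof
  fix X Y :: "real set set"
  show "0 \<le> measure_class_dist X Y" by (simp add: measure_class_dist_def)
  show "measure_class_dist X Y = measure_class_dist Y X"
    by (simp add: measure_class_dist_def Un_commute Int_commute)
next
  interpret finite_measure unit_lebesgue by (rule finite_measure_unit_lebesgue)
  fix X Y :: "real set set"
  assume "X \<in> carrier measure_ring" "Y \<in> carrier measure_ring"
  then obtain S T where ST: "S \<in> sets unit_lebesgue" "T \<in> sets unit_lebesgue"
    and XY: "X = measure_class S" "Y = measure_class T"
    by (auto simp: carrier_measure_ring)
  have "(S \<union> T) - (S \<inter> T) \<in> sets unit_lebesgue" using ST by auto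
  then show "measure_class_dist X Y = 0 \<longleftrightarrow> X = Y"
    using ST by (simp add: XY measure_class_dist_eq measure_class_eq_iff null_sets_def emeasure_eq_measure)
next
  interpret finite_measure unit_lebesgue by (rule finite_measure_unit_lebesgue)
  fix X Y Z :: "real set set"
  assume "X \<in> carrier measure_ring" "Y \<in> carrier measure_ring" "Z \<in> carrier measure_ring"
  then obtain S T U where STU: "S \<in> sets unit_lebesgue" "T \<in> sets unit_lebesgue" "U \<in> sets unit_lebesgue"
    and XYZ: "X = measure_class S" "Y = measure_class T" "Z = measure_class U"
    by (auto simp: carrier_measure_ring)
  have "measure unit_lebesgue ((S \<union> U) - (S \<inter> U)) \<le>
      measure unit_lebesgue (((S \<union> T) - (S \<inter> T)) \<union> ((T \<union> U) - (T \<inter> U)))"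
    using STU by (intro finite_measure_mono) auto
  also have "\<dots> \<le> measure unit_lebesgue ((S \<union> T) - (S \<inter> T)) + measure unit_lebesgue ((T \<union> U) - (T \<inter> U))"
    using STU by (intro measure_Un_le) auto
  finally show "measure_class_dist X Z \<le> measure_class_dist X Y + measure_class_dist Y Z"
    using STU by (simp add: XYZ measure_class_dist_eq)
qed

end

theory Submission
  imports Defs
begin

text \<open>
  Let \<open>Q\<close> be the preimage of \<open>P\<close> among the measurable sets. If the complement of an interval lies
  in \<open>Q\<close>, it is the product of the complements of the two halves, so one of these lies in \<open>Q\<close> too.
  Bisecting repeatedly, \<open>Q\<close> contains complements of arbitrarily short intervals. Multiplying any \<open>S\<close>
  by such a complement gives an element of \<open>Q\<close> arbitrarily close to \<open>S\<close>.
\<close>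

text \<open>\<open>measure_class\<close> is the quotient homomorphism, and preimages of prime ideals
  under homomorphisms are prime. This lets the bisection work with actual sets instead of
  classes.\<close>

lemma primeideal_vimage_measure_class:
  assumes "primeideal P measure_ring"
  shows "primeideal {S \<in> sets unit_lebesgue. measure_class S \<in> P} measurable_set_ring"
proof -
  interpret hom: ring_hom_ring measurable_set_ring measure_ring measure_class
    using ideal.rcos_ring_hom_ring[OF ideal_null_sets]
    by (simp add: measure_ring_def measure_class_def[abs_def])
  show ?thesis
    using hom.primeideal_vimage[OF cring_measurable_set_ring assms] by simp
qed

lemma primeideal_contains_interval_complement:
  assumes "primeideal Q measurable_set_ring"
  shows "\<exists>a b. a \<le> b \<and> b - a = 1 / 2 ^ n \<and> {0..1} - {a..b} \<in> Q"
proof (induction n)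
  interpret primeideal Q measurable_set_ring by (rule assms)
  case 0
  have "{} \<in> Q" using additive_subgroup.zero_closed[OF is_additive_subgroup] by simp
  \<comment> \<open>The bisection starts from the whole unit interval, whose complement is the zero
    of the ring.\<close>
  then show ?case by (intro exI[of _ 0] exI[of _ 1]) simp
next
  interpret primeideal Q measurable_set_ring by (rule assms)
  case (Suc n)
  then obtain a b where ab: "a \<le> b" "b - a = 1 / 2 ^ n" and Q: "{0..1} - {a..b} \<in> Q" by blast
  define m where "m = (a + b) / 2"
  have m: "a \<le> m" "m \<le> b" "m - a = 1 / 2 ^ Suc n" "b - m = 1 / 2 ^ Suc n"
    using ab by (auto simp: m_def field_simps)
  have "({0..1} - {a..m}) \<inter> ({0..1} - {m..b}) = {0..1} - {a..b}"
    using m by auto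
  moreover have "{0..1} - {c..d} \<in> sets unit_lebesgue" for c d :: real
    by (simp add: sets_restrict_space_iff)
  ultimately have "{0..1} - {a..m} \<in> Q \<or> {0..1} - {m..b} \<in> Q"
    using I_prime[of "{0..1} - {a..m}" "{0..1} - {m..b}"] Q by simp
  then show ?case using m by blast
qed

lemma primeideal_measurable_set_ring_dense:
  assumes "primeideal Q measurable_set_ring" and S: "S \<in> sets unit_lebesgue" and "0 < e"
  shows "\<exists>T\<in>Q. measure unit_lebesgue ((S \<union> T) - (S \<inter> T)) < e"
proof -
  interpret primeideal Q measurable_set_ring by (rule assms(1))
  obtain n where n: "1 / 2 ^ n < e"
    using real_arch_pow_inv[OF \<open>0 < e\<close>, of "1/2"] by (auto simp: power_divide)
  obtain a b where ab: "a \<le> b" "b - a = 1 / 2 ^ n" and Q: "{0..1} - {a..b} \<in> Q"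
    using primeideal_contains_interval_complement[OF assms(1)] by blast
  define T where "T = S \<inter> ({0..1} - {a..b})"
  have "T \<in> Q" using I_l_closed[OF Q] S by (simp add: T_def)
  have "S \<in> sets lebesgue" using S by (simp add: sets_restrict_space_iff)
  have "(S \<union> T) - (S \<inter> T) = S \<inter> {a..b}"
    using sets_unit_lebesgue_subset[OF S] by (auto simp: T_def)
  \<comment> \<open>Passing to Lebesgue measure on the line gives the bound \<open>b - a\<close>
    without having to know that \<open>{a..b}\<close> lies in the unit interval.\<close>
  then have "measure unit_lebesgue ((S \<union> T) - (S \<inter> T)) = measure lebesgue (S \<inter> {a..b})"
    using sets_unit_lebesgue_subset[OF S] by (simp add: measure_restrict_space le_infI1)
  also have "\<dots> \<le> measure lebesgue {a..b}"
    using \<open>S \<in> sets lebesgue\<close> by (intro measure_mono_fmeasurable) auto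
  also have "\<dots> < e" using ab n by simp
  finally show ?thesis using \<open>T \<in> Q\<close> by blast
qed

text \<open>On representatives the distance is the measure of the symmetric difference, so density
  of the preimage of \<open>P\<close> makes every ball meet \<open>P\<close>.\<close>

lemma closure_of_primeideal_measure_ring:
  assumes P: "primeideal P measure_ring"
  shows "measure_ring_topology closure_of P = carrier measure_ring"
proof -
  interpret Metric_space "carrier measure_ring" measure_class_dist
    by (rule Metric_space_measure_ring)
  have PQ: "\<exists>Y\<in>P. Y \<in> mball X r" if X: "X \<in> carrier measure_ring" and "0 < r" for X r
  proof -
    obtain S where S: "S \<in> sets unit_lebesgue" and XS: "X = measure_class S"
      using X by (auto simp: carrier_measure_ring)
    obtain T where T: "T \<in> sets unit_lebesgue" "measure_class T \<in> P"
      and "measure unit_lebesgue ((S \<union> T) - (S \<inter> T)) < r"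
      using primeideal_measurable_set_ring_dense[OF primeideal_vimage_measure_class[OF P] S \<open>0 < r\<close>]
      by blast
    then have "measure_class T \<in> mball X r"
      using S X unfolding in_mball XS by (simp add: measure_class_dist_eq carrier_measure_ring)
    with T show ?thesis by blast
  qed
  then show ?thesis
    by (auto simp: measure_ring_topology_def metric_closure_of)
qed

theorem lemma2:
  shows "(\<forall>P. primeideal P measure_ring \<longrightarrow>
            measure_ring_topology closure_of P = carrier measure_ring) \<and>
         \<not> (\<exists>P. primeideal P measure_ring \<and> closedin measure_ring_topology P)"
  \<comment> \<open>A closed prime ideal would equal its closure, the whole ring, contradicting
    properness.\<close>
  using closure_of_primeideal_measure_ring closure_of_closedin primeideal.I_notcarr by metis

end
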